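(* Let $1<p<\infty$ and let $a=(a_n)_{n\in\mathbb{Z}}\in\ell^p(\mathbb{Z})$. For $n\in\mathbb{Z}$ and $k\in\mathbb{N}=\{0,1,2,\dots\}$ define $$U(n,k)=\sum_{m\in\mathbb{Z}}P_k(n-m)\,a_m,\qquad V(n,k)=\sum_{m\in\mathbb{Z}}Q_k(n-m)\,a_m,$$ where $$P_k(n)=\frac1{2\pi}\int_{-\pi}^{\pi}\rho(\theta)^k e^{\mathrm{i}n\theta}\,d\theta,\qquad Q_k(n)=\frac1{2\pi}\int_{-\pi}^{\pi}(-\mathrm{i}\,\operatorname{sgn}\theta)\,\rho(\theta)^{k+\frac12}e^{\mathrm{i}(n+\frac12)\theta}\,d\theta,$$ and $\rho(\theta)=2-\cos\theta-\sqrt{(2-\cos\theta)^2-1}$. Then: (a) (Discrete harmonicity) For $F=U$ and for $F=V$, and for all $n\in\mathbb{Z}$, $k\ge1$, $$F(n+1,k)+F(n-1,k)+F(n,k+1)+F(n,k-1)-4F(n,k)=0.$$ (b) (Boundary values) For all $n\in\mathbb{Z}$, $U(n,0)=a_n$ and $V(n,0)=(H_{\mathrm d}a)_n$, where $H_{\mathrm d}$ is the discrete Hilbert transform with Fourier multiplier $m_{\mathrm d}(\theta)=(-\mathrm{i}\,\operatorname{sgn}\theta)\,\rho(\theta)^{1/2}e^{\mathrm{i}\theta/2}$. (c) (Discrete Cauchy--Riemann relations) For all $n\in\mathbb{Z}$ and $k\ge1$, $$U(n+1,k)-U(n,k)=V(n,k)-V(n,k-1),$$ $$U(n,k+1)-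U(n,k)=-\bigl(V(n,k)-V(n-1,k)\bigr).$$
   Context: $\mathbb{N}=\{0,1,2,\dots\}$; sequences are real- or complex-valued; $\operatorname{sgn}0=0$. The function $\rho:(-\pi,\pi]\to(0,1]$ is the root in $(0,1]$ of $\rho+\rho^{-1}=4-2\cos\theta$, i.e. $\rho(\theta)=2-\cos\theta-\sqrt{(2-\cos\theta)^2-1}$. Fourier conventions: $\widehat a(\theta)=\sum_{n\in\mathbb{Z}}a_n e^{-\mathrm{i}n\theta}$ for $a\in\ell^1(\mathbb{Z})$, and $\mathcal{F}^{-1}[g](n)=\frac1{2\pi}\int_{-\pi}^{\pi}g(\theta)e^{\mathrm{i}n\theta}\,d\theta$ for $g\in L^1((-\pi,\pi])$. The discrete Hilbert transform $H_{\mathrm d}$ is the operator with Fourier multiplier $m_{\mathrm d}(\theta)=(-\mathrm{i}\,\operatorname{sgn}\theta)\rho(\theta)^{1/2}e^{\mathrm{i}\theta/2}$, formally $(H_{\mathrm d}a)_n=\mathcal{F}^{-1}[m_{\mathrm d}\,\widehat a](n)$. For $a\in\ell^p(\mathbb{Z})$, $1\le p<\infty$, it is understood as the convolution $H_{\mathrm d}a=K_{\mathrm d}*a$, $(H_{\mathrm d}a)_n=\sum_{m}K_{\mathrm d}(n-m)a_m$, with $K_{\mathrm d}=\mathcal{F}^{-1}[m_{\mathrm d}]$, that is $K_{\mathrm d}(n)=\frac1\pi\int_0^\pi\rho(\theta)^{1/2}\sin((n+\tfrac12)\theta)\,d\theta$. *)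

theory Defs
  imports "HOL-Analysis.Analysis"
begin

definition rho :: "real \<Rightarrow> real" where
  "rho \<theta> = 2 - cos \<theta> - sqrt ((2 - cos \<theta>)\<^sup>2 - 1)"

definition in_lp :: "real \<Rightarrow> (int \<Rightarrow> complex) \<Rightarrow> bool" where
  "in_lp p a \<longleftrightarrow> (\<lambda>n. norm (a n) powr p) summable_on UNIV"

definition inv_fourier :: "(real \<Rightarrow> complex) \<Rightarrow> int \<Rightarrow> complex" where
  "inv_fourier g n =
     1 / (2 * pi) * (LINT \<theta>:{-pi<..pi}|lborel. g \<theta> * exp (\<i> * of_int n * of_real \<theta>))"

text \<open>The sum below is an unordered (for complex terms: absolutely convergent) sum, and it
  is \<open>0\<close> by convention if it does not converge.\<close>

definition conv :: "(int \<Rightarrow> complex) \<Rightarrow> (int \<Rightarrow> complex) \<Rightarrow> int \<Rightarrow> complex" where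
  "conv K a n = (\<Sum>\<^sub>\<infinity>m. K (n - m) * a m)"

definition P :: "nat \<Rightarrow> int \<Rightarrow> complex" where
  "P k n =
     1 / (2 * pi) *
     (LINT \<theta>:{-pi<..pi}|lborel. of_real (rho \<theta> ^ k) * exp (\<i> * of_int n * of_real \<theta>))"

definition Q :: "nat \<Rightarrow> int \<Rightarrow> complex" where
  "Q k n =
     1 / (2 * pi) *
     (LINT \<theta>:{-pi<..pi}|lborel.
        (- \<i> * of_real (sgn \<theta>)) * of_real (rho \<theta> powr (real k + 1 / 2))
          * exp (\<i> * (of_int n + 1 / 2) * of_real \<theta>))"

definition U :: "(int \<Rightarrow> complex) \<Rightarrow> int \<Rightarrow> nat \<Rightarrow> complex" where
  "U a n k = conv (P k) a n"

definition V :: "(int \<Rightarrow> complex) \<Rightarrow> int \<Rightarrow> nat \<Rightarrow> complex" where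
  "V a n k = conv (Q k) a n"

definition m_d :: "real \<Rightarrow> complex" where
  "m_d \<theta> = (- \<i> * of_real (sgn \<theta>)) * of_real (rho \<theta> powr (1 / 2)) * exp (\<i> * of_real \<theta> / 2)"

definition K_d :: "int \<Rightarrow> complex" where
  "K_d = inv_fourier m_d"

text \<open>On \<open>\<ell>\<^sup>p\<close>, \<open>1 \<le> p < \<infinity>\<close>, the operator with Fourier multiplier \<open>m_d\<close> is understood as
  convolution with the inverse Fourier transform of \<open>m_d\<close>.\<close>

definition H_d :: "(int \<Rightarrow> complex) \<Rightarrow> int \<Rightarrow> complex" where
  "H_d a = conv K_d a"

end

theory Submission imports Defs
begin

text \<open>Put \<open>s = \<bar>sin (\<theta>/2)\<bar>\<close>. Then \<open>r = sqrt (1 + s\<^sup>2) - s\<close> is the square root of \<open>rho\<close>, and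
  \<open>1 - r\<^sup>2 = 2 s r\<close>. All pointwise identities between the multipliers of \<open>P\<close> and \<open>Q\<close> follow from
  this relation and \<open>exp (i\<theta>) - 1 = 2 i sin (\<theta>/2) exp (i\<theta>/2)\<close>. The multipliers are continuously
  differentiable on \<open>[-\<pi>, 0]\<close> and \<open>[0, \<pi>]\<close> separately, with a possible jump at 0, so one integration by parts
  on each half shows that the kernels are \<open>O(1/|n|)\<close>. They therefore lie in \<open>\<ell>\<^sup>q\<close> for every \<open>q > 1\<close>,
  and by Young's inequality all the convolutions converge absolutely, which transfers the
  kernel identities to \<open>U\<close> and \<open>V\<close>.\<close>

section \<open>Decay of Fourier coefficients and convolution\<close>

lemma set_integrable_bounded:
  fixes f :: "real \<Rightarrow> complex"
  assumes [measurable]: "f \<in> borel_measurable borel" and "\<And>x. norm (f x) \<le> B"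
  shows "set_integrable lborel {a<..b} f"
  unfolding set_integrable_def
proof (rule Bochner_Integration.integrable_bound)
  show "integrable lborel (\<lambda>x. indicator {a<..b} x *\<^sub>R B)"
    by (cases "a \<le> b") auto
  show "AE x in lborel. norm (indicator {a<..b} x *\<^sub>R f x) \<le> norm (indicator {a<..b} x *\<^sub>R B)"
    using assms(2) by (auto split: split_indicator intro!: AE_I2 order_trans[OF _ abs_ge_self])
qed measurable

section \<open>Bounded multipliers and the calculus of the inverse transform\<close>

text \<open>A class closed under sums and products that contains the exponentials, so that
  integrability of each Fourier integrand follows from membership.\<close>

definition bounded_multiplier :: "(real \<Rightarrow> complex) \<Rightarrow> bool" where
  "bounded_multiplier g \<longleftrightarrow> g \<in> borel_measurable borel \<and> (\<exists>B. \<forall>\<theta>. norm (g \<theta>) \<le> B)"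

lemma bounded_multiplier_add [intro]:
  assumes "bounded_multiplier f" "bounded_multiplier g"
  shows "bounded_multiplier (\<lambda>\<theta>. f \<theta> + g \<theta>)"
proof -
  from assms obtain B C where "\<forall>\<theta>. norm (f \<theta>) \<le> B" "\<forall>\<theta>. norm (g \<theta>) \<le> C"
    unfolding bounded_multiplier_def by blast
  then have "norm (f \<theta> + g \<theta>) \<le> B + C" for \<theta>
    by (meson add_mono norm_triangle_le)
  then show ?thesis using assms unfolding bounded_multiplier_def by auto
qed

lemma bounded_multiplier_mult [intro]:
  assumes "bounded_multiplier f" "bounded_multiplier g"
  shows "bounded_multiplier (\<lambda>\<theta>. f \<theta> * g \<theta>)"
proof -
  from assms obtain B C where "\<forall>\<theta>. norm (f \<theta>) \<le> B" "\<forall>\<theta>. norm (g \<theta>) \<le> C"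
    unfolding bounded_multiplier_def by blast
  then have "norm (f \<theta> * g \<theta>) \<le> B * C" for \<theta>
    unfolding norm_mult by (intro mult_mono) (auto intro: order_trans[OF norm_ge_zero])
  then show ?thesis using assms unfolding bounded_multiplier_def by auto
qed

lemma bounded_multiplier_const [intro]: "bounded_multiplier (\<lambda>_. c)"
  unfolding bounded_multiplier_def by auto

lemma bounded_multiplier_exp [intro]: "bounded_multiplier (\<lambda>\<theta>. exp (\<i> * of_int k * of_real \<theta>))"
  unfolding bounded_multiplier_def
proof (intro conjI exI[of _ 1] allI)
  show "norm (exp (\<i> * of_int k * of_real \<theta>)) \<le> 1" for \<theta> :: real
    by (simp add: norm_exp_eq_Re)
qed (intro borel_measurable_continuous_onI continuous_intros)

lemma set_integrable_inv_fourier: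
  assumes "bounded_multiplier g"
  shows "set_integrable lborel {-pi<..pi} (\<lambda>\<theta>. g \<theta> * exp (\<i> * of_int n * of_real \<theta>))"
proof -
  have "bounded_multiplier (\<lambda>\<theta>. g \<theta> * exp (\<i> * of_int n * of_real \<theta>))"
    using assms by auto
  then show ?thesis
    unfolding bounded_multiplier_def using set_integrable_bounded by blast
qed

lemma inv_fourier_cong:
  assumes "\<And>\<theta>. - pi < \<theta> \<Longrightarrow> \<theta> \<le> pi \<Longrightarrow> f \<theta> = g \<theta>"
  shows "inv_fourier f n = inv_fourier g n"
  unfolding inv_fourier_def
  by (rule arg_cong[where f = "(*) _"], rule set_lebesgue_integral_cong) (auto simp: assms)

lemma inv_fourier_add:
  assumes "bounded_multiplier f" "bounded_multiplier g"
  shows "inv_fourier (\<lambda>\<theta>. f \<theta> + g \<theta>) n = inv_fourier f n + inv_fourier g n"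
  using set_integral_add(2)[OF set_integrable_inv_fourier[OF assms(1)] set_integrable_inv_fourier[OF assms(2)]]
  unfolding inv_fourier_def by (simp add: algebra_simps)

lemma inv_fourier_diff:
  assumes "bounded_multiplier f" "bounded_multiplier g"
  shows "inv_fourier (\<lambda>\<theta>. f \<theta> - g \<theta>) n = inv_fourier f n - inv_fourier g n"
  using set_integral_diff(2)[OF set_integrable_inv_fourier[OF assms(1)] set_integrable_inv_fourier[OF assms(2)]]
  unfolding inv_fourier_def by (simp only: left_diff_distrib right_diff_distrib)

lemma inv_fourier_cmult:
  "inv_fourier (\<lambda>\<theta>. c * f \<theta>) n = c * inv_fourier f n"
  unfolding inv_fourier_def by (simp add: mult.assoc)

text \<open>Modulating a multiplier translates its kernel; \<open>k = 1\<close> and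
  \<open>k = - 1\<close> produce the horizontal neighbours of \<open>n\<close>.\<close>

lemma inv_fourier_shift:
  "inv_fourier (\<lambda>\<theta>. exp (\<i> * of_int k * of_real \<theta>) * f \<theta>) n = inv_fourier f (n + k)"
  unfolding inv_fourier_def by (simp add: ring_distribs exp_add mult_ac)

section \<open>Decay of order 1/|n| on each half period\<close>

text \<open>The exponential has modulus 1 and its derivative carries the factor \<open>i n\<close>,
  so integration by parts leaves boundary values and an integral of \<open>f'\<close>, bounded
  uniformly in \<open>n\<close>.\<close>

lemma oscillatory_integral_bound:
  fixes f :: "real \<Rightarrow> complex"
  assumes f: "f C1_differentiable_on {a..b}" and "a \<le> b"
  obtains C where "\<And>n. n \<noteq> 0 \<Longrightarrow> norm (integral {a..b} (\<lambda>\<theta>. f \<theta> * exp (\<i> * of_int n * of_real \<theta>))) \<le> C / \<bar>of_int n\<bar>"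
proof -
  obtain f' where f': "\<And>x. x \<in> {a..b} \<Longrightarrow> (f has_vector_derivative f' x) (at x)"
    and cf': "continuous_on {a..b} f'"
    using f unfolding C1_differentiable_on_def by blast
  have cf: "continuous_on {a..b} f"
    using f' by (meson continuous_at_imp_continuous_on has_vector_derivative_continuous)
  obtain B where B: "\<And>x. x \<in> {a..b} \<Longrightarrow> norm (f' x) \<le> B"
    using compact_imp_bounded[OF compact_continuous_image[OF cf' compact_Icc]]
    unfolding bounded_iff by blast
  show ?thesis
  \<comment> \<open>Two boundary terms, plus the interval length times the bound \<open>B\<close> on
    \<open>f'\<close>.\<close>
  proof (rule that[of "norm (f b) + norm (f a) + B * (b - a)"])
    fix n :: int assume n: "n \<noteq> 0"
    define e where "e \<theta> = exp (\<i> * of_int n * of_real \<theta>)" for \<theta> :: real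
    have ne: "norm (e \<theta>) = 1" for \<theta> by (simp add: e_def norm_exp_eq_Re)
    have ce: "continuous_on {a..b} e" unfolding e_def by (intro continuous_intros)
    have de: "(e has_vector_derivative \<i> * of_int n * e x) (at x)" for x
    proof -
      have "((\<lambda>z. exp (\<i> * of_int n * z)) has_field_derivative \<i> * of_int n * e x) (at (of_real x))"
        unfolding e_def by (auto intro!: derivative_eq_intros)
      from has_vector_derivative_real_field[OF this] show ?thesis
        by (simp add: e_def[abs_def])
    qed
    have "((\<lambda>x. f' x * e x + \<i> * of_int n * (f x * e x)) has_integral f b * e b - f a * e a) {a..b}"
    proof (rule fundamental_theorem_of_calculus[OF \<open>a \<le> b\<close>])
      fix x assume x: "x \<in> {a..b}"
      have "((\<lambda>x. f x * e x) has_vector_derivative f x * (\<i> * of_int n * e x) + f' x * e x) (at x)"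
        by (rule has_vector_derivative_mult[OF f'[OF x] de])
      then show "((\<lambda>x. f x * e x) has_vector_derivative f' x * e x + \<i> * of_int n * (f x * e x)) (at x within {a..b})"
        by (auto intro: has_vector_derivative_at_within simp: algebra_simps)
    qed
    then have "integral {a..b} (\<lambda>x. f' x * e x + \<i> * of_int n * (f x * e x)) = f b * e b - f a * e a"
      by blast
    moreover have "integral {a..b} (\<lambda>x. f' x * e x + \<i> * of_int n * (f x * e x)) =
        integral {a..b} (\<lambda>x. f' x * e x) + \<i> * of_int n * integral {a..b} (\<lambda>x. f x * e x)"
      by (subst Henstock_Kurzweil_Integration.integral_add)
        (auto intro!: integrable_continuous_real continuous_intros cf cf' ce)
    ultimately have "\<i> * of_int n * integral {a..b} (\<lambda>x. f x * e x)
        = f b * e b - f a * e a - integral {a..b} (\<lambda>x. f' x * e x)"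
      by (simp add: algebra_simps)
    then have "norm (\<i> * of_int n * integral {a..b} (\<lambda>x. f x * e x))
        = norm (f b * e b - f a * e a - integral {a..b} (\<lambda>x. f' x * e x))"
      by (rule arg_cong)
    also have "\<dots> \<le> norm (f b) + norm (f a) + norm (integral {a..b} (\<lambda>x. f' x * e x))"
      using norm_triangle_ineq4[of "f b * e b - f a * e a" "integral {a..b} (\<lambda>x. f' x * e x)"]
        norm_triangle_ineq4[of "f b * e b" "f a * e a"] by (simp add: norm_mult ne)
    also have "norm (integral {a..b} (\<lambda>x. f' x * e x)) \<le> B * (b - a)"
      by (rule integral_bound[OF \<open>a \<le> b\<close>]) (auto intro!: continuous_intros cf' ce simp: norm_mult ne B)
    finally have "\<bar>of_int n\<bar> * norm (integral {a..b} (\<lambda>x. f x * e x)) \<le> norm (f b) + norm (f a) + B * (b - a)"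
      by (simp add: norm_mult)
    then show "norm (integral {a..b} (\<lambda>\<theta>. f \<theta> * exp (\<i> * of_int n * of_real \<theta>)))
        \<le> (norm (f b) + norm (f a) + B * (b - a)) / \<bar>of_int n\<bar>"
      using n unfolding e_def by (subst pos_le_divide_eq) (auto simp: mult.commute)
  qed
qed

text \<open>\<open>C1_differentiable_on\<close> asks for two-sided derivatives at the endpoints as
  well. Since \<open>g\<close> may have a jump or a corner at 0, it is replaced on each half by a
  function differentiable across the endpoints.\<close>

lemma inv_fourier_decay:
  assumes g: "bounded_multiplier g"
    and f1: "f1 C1_differentiable_on {-pi..0}" and f2: "f2 C1_differentiable_on {0..pi}"
    and g1: "\<And>\<theta>. - pi < \<theta> \<Longrightarrow> \<theta> < 0 \<Longrightarrow> g \<theta> = f1 \<theta>"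
    and g2: "\<And>\<theta>. 0 < \<theta> \<Longrightarrow> \<theta> < pi \<Longrightarrow> g \<theta> = f2 \<theta>"
  obtains C where "\<And>n. n \<noteq> 0 \<Longrightarrow> norm (inv_fourier g n) \<le> C / \<bar>of_int n\<bar>"
proof -
  obtain C1 where C1: "\<And>n. n \<noteq> 0 \<Longrightarrow> norm (integral {-pi..0} (\<lambda>\<theta>. f1 \<theta> * exp (\<i> * of_int n * of_real \<theta>))) \<le> C1 / \<bar>of_int n\<bar>"
    using oscillatory_integral_bound[OF f1] by auto
  obtain C2 where C2: "\<And>n. n \<noteq> 0 \<Longrightarrow> norm (integral {0..pi} (\<lambda>\<theta>. f2 \<theta> * exp (\<i> * of_int n * of_real \<theta>))) \<le> C2 / \<bar>of_int n\<bar>"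
    using oscillatory_integral_bound[OF f2] by auto
  show ?thesis
  proof (rule that[of "(C1 + C2) / (2 * pi)"])
    fix n :: int assume n: "n \<noteq> 0"
    let ?g = "\<lambda>f \<theta>. f \<theta> * exp (\<i> * of_int n * of_real \<theta>)"
    have c1: "continuous_on {-pi..0} f1" and c2: "continuous_on {0..pi} f2"
      using f1 f2 by (auto intro: C1_differentiable_imp_continuous_on)
    \<comment> \<open>\<open>g\<close> and its branch can differ only at the endpoints, a finite set
      that does not affect the integral.\<close>
    have h1: "(?g g has_integral integral {-pi..0} (?g f1)) {-pi..0}"
      by (rule has_integral_spike_finite[of "{-pi,0}" _ _ "?g f1"])
        (auto simp: g1 intro!: integrable_integral integrable_continuous_real continuous_intros c1)
    have h2: "(?g g has_integral integral {0..pi} (?g f2)) {0..pi}"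
      by (rule has_integral_spike_finite[of "{0,pi}" _ _ "?g f2"])
        (auto simp: g2 intro!: integrable_integral integrable_continuous_real continuous_intros c2)
    have h: "(?g g has_integral integral {-pi..0} (?g f1) + integral {0..pi} (?g f2)) {-pi..pi}"
      by (rule has_integral_combine[OF _ _ h1 h2]) auto
    have "integral {-pi<..pi} (?g g) = integral {-pi..pi} (?g g)"
      by (rule integral_subset_negligible) (auto intro!: negligible_subset[of "{-pi}"])
    then have "inv_fourier g n = 1 / (2 * pi) * (integral {-pi..0} (?g f1) + integral {0..pi} (?g f2))"
      unfolding inv_fourier_def using h
      by (simp add: set_borel_integral_eq_integral(2)[OF set_integrable_inv_fourier[OF g]] integral_unique)
    then have "norm (inv_fourier g n) = norm (integral {-pi..0} (?g f1) + integral {0..pi} (?g f2)) / (2 * pi)"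
      by (simp add: norm_mult norm_divide)
    also have "\<dots> \<le> (C1 / \<bar>of_int n\<bar> + C2 / \<bar>of_int n\<bar>) / (2 * pi)"
      by (intro divide_right_mono norm_triangle_mono C1 C2 n) auto
    finally show "norm (inv_fourier g n) \<le> (C1 + C2) / (2 * pi) / \<bar>of_int n\<bar>"
      by (simp add: add_divide_distrib mult.commute)
  qed
qed

section \<open>Summability of kernels and of convolution terms\<close>

text \<open>Two copies of the naturals, \<open>n\<close> and \<open>- n\<close>, cover the integers;
  they meet only in 0, where \<open>0 powr - q\<close> is 0.\<close>

lemma summable_on_int_powr:
  fixes q :: real
  assumes "1 < q"
  shows "(\<lambda>n::int. \<bar>of_int n\<bar> powr - q) summable_on UNIV"
proof -
  have s: "(\<lambda>n::nat. real n powr - q) summable_on UNIV"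
    using assms by (subst summable_on_UNIV_nonneg_real_iff) (auto simp: summable_real_powr_iff)
  have "(\<lambda>n::int. \<bar>of_int n\<bar> powr - q) summable_on range int"
    by (subst summable_on_reindex) (auto simp: o_def s)
  moreover have "(\<lambda>n::int. \<bar>of_int n\<bar> powr - q) summable_on range (\<lambda>n. - int n)"
    by (subst summable_on_reindex) (auto simp: o_def s inj_def)
  moreover have "(UNIV :: int set) = range int \<union> range (\<lambda>n. - int n)"
    by (auto simp: image_iff) (metis int_cases2)
  ultimately show ?thesis
    by (metis summable_on_union)
qed

text \<open>Comparison with the power series away from 0. The decay bound says nothing about
  \<open>K 0\<close>, whose single term is added at the end.\<close>

lemma in_lp_decay:
  assumes "1 < q" and K: "\<And>n. n \<noteq> 0 \<Longrightarrow> norm (K n) \<le> C / \<bar>of_int n\<bar>"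
  shows "in_lp q K"
proof -
  have "0 \<le> C" using K[of 1] by (simp add: order_trans[OF norm_ge_zero])
  have "(\<lambda>n. C powr q * \<bar>of_int n\<bar> powr - q) summable_on - {0::int}"
    by (rule summable_on_cmult_right, rule summable_on_subset_banach[OF summable_on_int_powr[OF assms(1)]]) auto
  then have "(\<lambda>n. norm (K n) powr q) summable_on - {0}"
  proof (rule summable_on_comparison_test)
    fix n :: int assume "n \<in> - {0}"
    then have "norm (K n) powr q \<le> (C / \<bar>of_int n\<bar>) powr q"
      using K assms(1) by (intro powr_mono2) auto
    also have "\<dots> = C powr q * \<bar>of_int n\<bar> powr - q"
      using \<open>0 \<le> C\<close> by (simp add: powr_divide powr_minus_divide)
    finally show "norm (K n) powr q \<le> C powr q * \<bar>of_int n\<bar> powr - q" .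
  qed auto
  then have "(\<lambda>n. norm (K n) powr q) summable_on (- {0} \<union> {0})"
    by (intro summable_on_union) auto
  then show ?thesis by (simp only: in_lp_def Compl_partition2)
qed

text \<open>Young's inequality for two numbers bounds each term by a sum of two summable families;
  the kernel family is summable because \<open>m\<close> to \<open>n - m\<close> permutes the
  integers.\<close>

lemma conv_summable:
  assumes p: "1 < p" "in_lp p a" and q: "1 < q" "in_lp q K" and pq: "1 / q + 1 / p = 1"
  shows "(\<lambda>m. K (n - m) * a m) summable_on UNIV"
proof (rule abs_summable_summable)
  have "bij_betw (\<lambda>m::int. n - m) UNIV UNIV"
    by (rule bij_betwI[where g = "\<lambda>m. n - m"]) auto
  from summable_on_reindex_bij_betw[OF this, of "\<lambda>m. norm (K m) powr q"] q
  have "(\<lambda>m. norm (K (n - m)) powr q) summable_on UNIV"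
    by (simp add: in_lp_def)
  then have "(\<lambda>m. norm (K (n - m)) powr q * (1 / q) + norm (a m) powr p * (1 / p)) summable_on UNIV"
    using p(2) unfolding in_lp_def by (intro summable_on_add summable_on_cmult_left)
  then show "(\<lambda>m. norm (K (n - m) * a m)) summable_on UNIV"
  proof (rule summable_on_comparison_test)
    fix m
    show "norm (K (n - m) * a m) \<le> norm (K (n - m)) powr q * (1 / q) + norm (a m) powr p * (1 / p)"
      using Youngs_inequality[of q p "norm (K (n - m))" "norm (a m)"] p q pq
      by (simp add: norm_mult)
  qed auto
qed

section \<open>Orthogonality of the exponentials on one period\<close>

lemma integral_exp_period:
  assumes "n \<noteq> 0"
  shows "integral {-pi..pi} (\<lambda>\<theta>. exp (\<i> * of_int n * of_real \<theta>)) = 0"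
proof -
  let ?F = "\<lambda>\<theta>::real. exp (\<i> * of_int n * of_real \<theta>) / (\<i> * of_int n)"
  have "(?F has_vector_derivative exp (\<i> * of_int n * of_real x)) (at x)" for x
  proof -
    have "((\<lambda>z. exp (\<i> * of_int n * z) / (\<i> * of_int n)) has_field_derivative
        exp (\<i> * of_int n * of_real x)) (at (of_real x))"
      using assms by (auto intro!: derivative_eq_intros)
    from has_vector_derivative_real_field[OF this] show ?thesis .
  qed
  then have "((\<lambda>\<theta>. exp (\<i> * of_int n * of_real \<theta>)) has_integral ?F pi - ?F (- pi)) {-pi..pi}"
    by (intro fundamental_theorem_of_calculus) (auto intro: has_vector_derivative_at_within)
  \<comment> \<open>The two exponents differ by \<open>2 pi i n\<close>, so the antiderivative
    agrees at both ends.\<close>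
  moreover have "exp (\<i> * of_int n * of_real pi) = exp (\<i> * of_int n * of_real (- pi))"
    by (subst exp_eq) (auto intro!: exI[of _ n] simp: algebra_simps)
  ultimately show ?thesis
    by (simp add: integral_unique)
qed

text \<open>Needed for \<open>P 0\<close>, whose multiplier is constantly 1. For
  \<open>n = 0\<close> the integral is the length \<open>2 pi\<close>; otherwise it vanishes over
  the full period.\<close>

lemma inv_fourier_one: "inv_fourier (\<lambda>_. 1) n = (if n = 0 then 1 else 0)"
proof -
  have "integral {-pi<..pi} (\<lambda>\<theta>. 1 * exp (\<i> * of_int n * of_real \<theta>))
      = integral {-pi..pi} (\<lambda>\<theta>. 1 * exp (\<i> * of_int n * of_real \<theta>))"
    by (rule integral_subset_negligible) (auto intro!: negligible_subset[of "{-pi}"])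
  then have "inv_fourier (\<lambda>_. 1) n
      = 1 / (2 * pi) * integral {-pi..pi} (\<lambda>\<theta>. exp (\<i> * of_int n * of_real \<theta>))"
    unfolding inv_fourier_def
    by (simp add: set_borel_integral_eq_integral(2)[OF set_integrable_inv_fourier[OF bounded_multiplier_const, of 1, simplified]])
  then show ?thesis
    using integral_exp_period[of n] by (simp add: scaleR_conv_of_real)
qed

lemma has_sum_diff:
  fixes f g :: "'a \<Rightarrow> 'b :: real_normed_vector"
  assumes "(f has_sum x) A" "(g has_sum y) A"
  shows "((\<lambda>i. f i - g i) has_sum (x - y)) A"
  using has_sum_add[OF assms(1), of "\<lambda>i. - g i" "- y"] assms(2) by (simp add: has_sum_uminus)

section \<open>The multipliers\<close>

definition root_rho :: "real \<Rightarrow> real" where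
  "root_rho \<theta> = sqrt (1 + (sin (\<theta> / 2))\<^sup>2) - \<bar>sin (\<theta> / 2)\<bar>"

lemma cos_eq_half: "cos \<theta> = 1 - 2 * (sin (\<theta> / 2))\<^sup>2" for \<theta> :: real
  using cos_double_sin[of "\<theta> / 2"] by simp

text \<open>Squaring \<open>root_rho + s = sqrt (1 + s^2)\<close> removes the radical. Harmonicity
  and the Cauchy-Riemann identities use \<open>root_rho\<close> only through this relation.\<close>

lemma root_rho_identity: "1 - (root_rho \<theta>)\<^sup>2 = 2 * \<bar>sin (\<theta> / 2)\<bar> * root_rho \<theta>"
proof -
  have "(root_rho \<theta> + \<bar>sin (\<theta> / 2)\<bar>)\<^sup>2 = 1 + (sin (\<theta> / 2))\<^sup>2"
    by (simp add: root_rho_def)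
  then show ?thesis by (simp add: power2_sum algebra_simps)
qed

lemma root_rho_pos: "0 < root_rho \<theta>"
proof -
  have "sqrt ((sin (\<theta> / 2))\<^sup>2) < sqrt (1 + (sin (\<theta> / 2))\<^sup>2)" by (subst real_sqrt_less_iff) simp
  then show ?thesis by (simp add: root_rho_def)
qed

lemma root_rho_le_1: "root_rho \<theta> \<le> 1"
proof -
  have "(root_rho \<theta>)\<^sup>2 \<le> 1"
    using root_rho_identity[of \<theta>] root_rho_pos[of \<theta>] by (smt (verit) abs_ge_zero mult_nonneg_nonneg)
  then show ?thesis using root_rho_pos[of \<theta>] by (simp add: power_le_one_iff)
qed

text \<open>With \<open>s = sin (theta / 2)\<close> the radicand becomes
  \<open>4 s^2 (1 + s^2)\<close>, so \<open>rho = 1 + 2 s^2 - 2 |s| sqrt (1 + s^2)\<close>, a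
  perfect square.\<close>

lemma rho_eq: "rho \<theta> = (root_rho \<theta>)\<^sup>2"
proof -
  let ?s = "sin (\<theta> / 2)"
  have "(2 - cos \<theta>)\<^sup>2 - 1 = 2\<^sup>2 * ?s\<^sup>2 * (1 + ?s\<^sup>2)"
    unfolding cos_eq_half[of \<theta>] by (simp add: algebra_simps power2_eq_square)
  then have "sqrt ((2 - cos \<theta>)\<^sup>2 - 1) = 2 * \<bar>?s\<bar> * sqrt (1 + ?s\<^sup>2)"
    by (simp add: real_sqrt_mult)
  then show ?thesis
    unfolding rho_def root_rho_def by (simp add: cos_eq_half[of \<theta>] power2_diff)
qed

text \<open>The square of \<open>root_rho_identity\<close>. It is the equation
  \<open>rho + 1 / rho = 4 - 2 cos theta\<close> cleared of its denominator.\<close>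

lemma root_rho_quartic: "1 + root_rho \<theta> ^ 4 = (4 - 2 * cos \<theta>) * (root_rho \<theta>)\<^sup>2"
proof -
  have "(1 - (root_rho \<theta>)\<^sup>2)\<^sup>2 = 4 * (sin (\<theta> / 2))\<^sup>2 * (root_rho \<theta>)\<^sup>2"
    unfolding root_rho_identity by (simp add: power_mult_distrib)
  then show ?thesis by (simp add: cos_eq_half[of \<theta>] power2_diff algebra_simps)
qed

text \<open>In terms of \<open>root_rho\<close>, integer powers of \<open>rho\<close> are even
  powers and half-integer ones (in \<open>Q_mult\<close>) are odd powers, so all exponents are
  natural numbers.\<close>

definition P_mult :: "nat \<Rightarrow> real \<Rightarrow> complex" where
  "P_mult k \<theta> = of_real (root_rho \<theta> ^ (2 * k))"

definition Q_mult :: "nat \<Rightarrow> real \<Rightarrow> complex" where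
  "Q_mult k \<theta> = of_real (root_rho \<theta> ^ (2 * k + 1)) * (- \<i> * of_real (sgn \<theta>) * exp (\<i> * of_real \<theta> / 2))"

lemma rho_powr: "rho \<theta> powr (real k + 1 / 2) = root_rho \<theta> ^ (2 * k + 1)"
proof -
  have "rho \<theta> powr (real k + 1 / 2) = root_rho \<theta> powr real (2 * k + 1)"
    using root_rho_pos[of \<theta>]
    by (simp add: rho_eq powr_powr algebra_simps flip: powr_numeral)
  then show ?thesis using root_rho_pos[of \<theta>] by (subst (asm) powr_realpow)
qed

lemma P_eq: "P k = inv_fourier (P_mult k)"
  by (rule ext) (simp add: P_def inv_fourier_def P_mult_def rho_eq power_mult)

text \<open>Splitting \<open>n + 1 / 2\<close> moves the half-step phase into the multiplier and
  leaves an ordinary Fourier coefficient at \<open>n\<close>.\<close>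

lemma Q_eq: "Q k = inv_fourier (Q_mult k)"
proof
  fix n
  have *: "exp (\<i> * (of_int n + 1 / 2) * of_real \<theta>) = exp (\<i> * of_real \<theta> / 2) * exp (\<i> * of_int n * of_real \<theta>)" for \<theta> :: real
    by (simp add: algebra_simps flip: exp_add)
  show "Q k n = inv_fourier (Q_mult k) n"
    unfolding Q_def inv_fourier_def Q_mult_def rho_powr * by (simp only: mult_ac)
qed

text \<open>\<open>m_d\<close> is the multiplier of \<open>Q\<close> at level 0, so
  \<open>V a n 0\<close> and \<open>H_d a n\<close> are the same convolution.\<close>

lemma K_d_eq: "K_d = Q 0"
proof -
  have "m_d = Q_mult 0"
    using rho_powr[of _ 0] by (auto simp: m_d_def Q_mult_def)
  then show ?thesis by (simp add: K_d_def Q_eq)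
qed

lemma root_rho_measurable [measurable]: "root_rho \<in> borel_measurable borel"
  unfolding root_rho_def by measurable

lemma root_rho_power_le_1: "\<bar>root_rho \<theta> ^ j\<bar> \<le> 1"
  using root_rho_pos[of \<theta>] root_rho_le_1[of \<theta>] by (simp add: power_le_one)

lemma bounded_P_mult [intro]: "bounded_multiplier (P_mult k)"
  unfolding bounded_multiplier_def
proof (intro conjI exI[of _ 1] allI)
  show "P_mult k \<in> borel_measurable borel" unfolding P_mult_def by measurable
  show "norm (P_mult k \<theta>) \<le> 1" for \<theta>
    unfolding P_mult_def norm_of_real by (rule root_rho_power_le_1)
qed

lemma bounded_Q_mult [intro]: "bounded_multiplier (Q_mult k)"
  unfolding bounded_multiplier_def
proof (intro conjI exI[of _ 1] allI)
  show "Q_mult k \<in> borel_measurable borel" unfolding Q_mult_def by measurable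
  show "norm (Q_mult k \<theta>) \<le> 1" for \<theta>
  proof -
    have "norm (- \<i> * of_real (sgn \<theta>) * exp (\<i> * of_real \<theta> / 2)) \<le> 1"
      by (simp add: norm_mult norm_exp_eq_Re sgn_if)
    then show ?thesis
      unfolding Q_mult_def norm_mult[of "of_real (root_rho \<theta> ^ (2 * k + 1))"] norm_of_real
      by (intro mult_le_one root_rho_power_le_1) auto
  qed
qed

section \<open>Smooth branches of the multipliers and \<open>in_lp\<close> membership of the
  kernels\<close>

lemma C1_power:
  fixes f :: "real \<Rightarrow> real"
  assumes "f C1_differentiable_on S"
  shows "(\<lambda>x. f x ^ j) C1_differentiable_on S"
  by (induction j) (auto intro: assms C1_differentiable_on_mult)

text \<open>The absolute value in \<^const>\<open>root_rho\<close> is not differentiable at 0, so smoothness is stated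
  for the two branches of opposite sign \<open>c\<close>.\<close>

lemma C1_root_rho_branch:
  "(\<lambda>\<theta>::real. sqrt (1 + (sin (\<theta> / 2))\<^sup>2) + c * sin (\<theta> / 2)) C1_differentiable_on S"
proof -
  let ?D = "\<lambda>\<theta>. inverse (sqrt (1 + (sin (\<theta> / 2))\<^sup>2)) / 2 * (sin (\<theta> / 2) * cos (\<theta> / 2)) + c * cos (\<theta> / 2) / 2"
  \<comment> \<open>The radicand is at least 1, so the square root is differentiable even where the
    sine vanishes.\<close>
  have pos: "1 + (sin (\<theta> / 2))\<^sup>2 > 0" for \<theta> :: real
    by (simp add: add_pos_nonneg)
  have "((\<lambda>\<theta>. sqrt (1 + (sin (\<theta> / 2))\<^sup>2) + c * sin (\<theta> / 2)) has_real_derivative ?D x) (at x)" for x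
  proof (rule DERIV_add)
    have "((\<lambda>\<theta>. 1 + (sin (\<theta> / 2))\<^sup>2) has_real_derivative sin (x / 2) * cos (x / 2)) (at x)"
      by (auto intro!: derivative_eq_intros)
    then show "((\<lambda>\<theta>. sqrt (1 + (sin (\<theta> / 2))\<^sup>2)) has_real_derivative
        inverse (sqrt (1 + (sin (x / 2))\<^sup>2)) / 2 * (sin (x / 2) * cos (x / 2))) (at x)"
      by (rule DERIV_chain2[where f = sqrt, rotated]) (rule DERIV_real_sqrt[OF pos])
    show "((\<lambda>\<theta>. c * sin (\<theta> / 2)) has_real_derivative c * cos (x / 2) / 2) (at x)"
      by (auto intro!: derivative_eq_intros)
  qed
  moreover have "continuous_on S ?D"
    by (intro continuous_intros ballI) (simp_all add: pos[THEN less_imp_neq, symmetric])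
  ultimately show ?thesis
    unfolding C1_differentiable_on_def has_real_derivative_iff_has_vector_derivative by (intro exI[of _ ?D]) simp
qed

lemma C1_cexp: "(\<lambda>\<theta>::real. c * exp (\<i> * of_real \<theta> / 2)) C1_differentiable_on S"
  unfolding C1_differentiable_on_def
proof (intro exI[of _ "\<lambda>\<theta>. c * (\<i> / 2 * exp (\<i> * of_real \<theta> / 2))"] conjI ballI)
  show "((\<lambda>\<theta>::real. c * exp (\<i> * of_real \<theta> / 2)) has_vector_derivative
      c * (\<i> / 2 * exp (\<i> * of_real x / 2))) (at x)" for x
  proof -
    have "((\<lambda>z. c * exp (\<i> * z / 2)) has_field_derivative
        c * (\<i> / 2 * exp (\<i> * of_real x / 2))) (at (of_real x))"
      by (auto intro!: derivative_eq_intros)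
    from has_vector_derivative_real_field[OF this] show ?thesis .
  qed
qed (intro continuous_intros, simp)

lemma root_rho_nonneg_branch:
  "0 < \<theta> \<Longrightarrow> \<theta> < pi \<Longrightarrow> root_rho \<theta> = sqrt (1 + (sin (\<theta> / 2))\<^sup>2) + (- 1) * sin (\<theta> / 2)"
  using sin_gt_zero[of "\<theta> / 2"] by (simp add: root_rho_def)

lemma root_rho_nonpos_branch:
  "- pi < \<theta> \<Longrightarrow> \<theta> < 0 \<Longrightarrow> root_rho \<theta> = sqrt (1 + (sin (\<theta> / 2))\<^sup>2) + 1 * sin (\<theta> / 2)"
  using sin_gt_zero[of "- \<theta> / 2"] by (simp add: root_rho_def)

lemma P_in_lp:
  assumes "1 < q"
  shows "in_lp q (P k)"
proof -
  \<comment> \<open>\<open>c\<close> is the sign opposite to theta: 1 on the negative half, -1 on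
    the positive one. Scaling the complex 1 makes the real branch complex-valued.\<close>
  let ?b = "\<lambda>c \<theta>. ((sqrt (1 + (sin (\<theta> / 2))\<^sup>2) + c * sin (\<theta> / 2)) ^ (2 * k)) *\<^sub>R (1 :: complex)"
  have C1: "?b c C1_differentiable_on S" for c S
    by (rule C1_differentiable_on_scaleR[OF C1_power[OF C1_root_rho_branch] C1_differentiable_on_const])
  obtain C where "\<And>n. n \<noteq> 0 \<Longrightarrow> norm (inv_fourier (P_mult k) n) \<le> C / \<bar>of_int n\<bar>"
  proof (rule inv_fourier_decay[of "P_mult k" "?b 1" "?b (- 1)", OF bounded_P_mult C1 C1])
    show "P_mult k \<theta> = ?b 1 \<theta>" if "- pi < \<theta>" "\<theta> < 0" for \<theta>
      unfolding P_mult_def root_rho_nonpos_branch[OF that] scaleR_conv_of_real by simp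
    show "P_mult k \<theta> = ?b (- 1) \<theta>" if "0 < \<theta>" "\<theta> < pi" for \<theta>
      unfolding P_mult_def root_rho_nonneg_branch[OF that] scaleR_conv_of_real by simp
  qed blast
  then show ?thesis
    unfolding P_eq by (rule in_lp_decay[OF assms])
qed

lemma Q_in_lp:
  assumes "1 < q"
  shows "in_lp q (Q k)"
proof -
  \<comment> \<open>As \<open>c = - sgn theta\<close> on each open half, \<open>i c\<close> is the
    factor \<open>- i sgn theta\<close>; freezing \<open>c\<close> removes the jump at 0.\<close>
  let ?b = "\<lambda>c \<theta>. ((sqrt (1 + (sin (\<theta> / 2))\<^sup>2) + c * sin (\<theta> / 2)) ^ (2 * k + 1)) *\<^sub>R
    (\<i> * of_real c * exp (\<i> * of_real \<theta> / 2))"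
  have C1: "?b c C1_differentiable_on S" for c S
    by (rule C1_differentiable_on_scaleR[OF C1_power[OF C1_root_rho_branch] C1_cexp])
  obtain C where "\<And>n. n \<noteq> 0 \<Longrightarrow> norm (inv_fourier (Q_mult k) n) \<le> C / \<bar>of_int n\<bar>"
  proof (rule inv_fourier_decay[of "Q_mult k" "?b 1" "?b (- 1)", OF bounded_Q_mult C1 C1])
    show "Q_mult k \<theta> = ?b 1 \<theta>" if "- pi < \<theta>" "\<theta> < 0" for \<theta>
      unfolding Q_mult_def root_rho_nonpos_branch[OF that] scaleR_conv_of_real using that by simp
    show "Q_mult k \<theta> = ?b (- 1) \<theta>" if "0 < \<theta>" "\<theta> < pi" for \<theta>
      unfolding Q_mult_def root_rho_nonneg_branch[OF that] scaleR_conv_of_real using that by simp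
  qed blast
  then show ?thesis
    unfolding Q_eq by (rule in_lp_decay[OF assms])
qed

section \<open>Identities between the kernels\<close>

text \<open>\<open>f\<close>, \<open>g\<close>, \<open>h\<close> stand for the multipliers at levels
  \<open>k - 1\<close>, \<open>k\<close>, \<open>k + 1\<close>. The two horizontal shifts together
  multiply \<open>g\<close> by \<open>2 cos theta\<close>, so the five-point Laplacian reduces to
  \<open>eq\<close>.\<close>

lemma inv_fourier_harmonic:
  assumes b: "bounded_multiplier f" "bounded_multiplier g" "bounded_multiplier h"
    and eq: "\<And>\<theta>. f \<theta> + h \<theta> = of_real (4 - 2 * cos \<theta>) * g \<theta>"
  shows "inv_fourier g (n + 1) + inv_fourier g (n - 1) + inv_fourier h n + inv_fourier f n
    - 4 * inv_fourier g n = 0"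
proof -
  let ?e = "\<lambda>k \<theta>. exp (\<i> * of_int k * of_real \<theta>)"
  have "f \<theta> + h \<theta> = 4 * g \<theta> - (?e 1 \<theta> * g \<theta> + ?e (- 1) \<theta> * g \<theta>)" for \<theta>
  proof -
    have "?e 1 \<theta> + ?e (- 1) \<theta> = of_real (2 * cos \<theta>)"
      by (simp add: cos_exp_eq flip: cos_of_real)
    then show ?thesis unfolding eq by (simp add: algebra_simps flip: distrib_left)
  qed
  then have "inv_fourier (\<lambda>\<theta>. f \<theta> + h \<theta>) n =
      inv_fourier (\<lambda>\<theta>. 4 * g \<theta> - (?e 1 \<theta> * g \<theta> + ?e (- 1) \<theta> * g \<theta>)) n"
    by (intro inv_fourier_cong)
  also have "\<dots> = inv_fourier (\<lambda>\<theta>. 4 * g \<theta>) n - (inv_fourier (\<lambda>\<theta>. ?e 1 \<theta> * g \<theta>) n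
      + inv_fourier (\<lambda>\<theta>. ?e (- 1) \<theta> * g \<theta>) n)"
    using b by (simp only: inv_fourier_diff inv_fourier_add bounded_multiplier_add
        bounded_multiplier_mult bounded_multiplier_exp bounded_multiplier_const)
  also have "\<dots> = 4 * inv_fourier g n - (inv_fourier g (n + 1) + inv_fourier g (n - 1))"
    by (simp only: inv_fourier_cmult inv_fourier_shift) simp
  finally show ?thesis using inv_fourier_add[OF b(1,3)] by (simp add: algebra_simps)
qed

text \<open>The quartic relation times a power. One level is an exponent step of 2: even
  \<open>j\<close> serves \<open>P\<close>, odd \<open>j\<close> serves \<open>Q\<close>.\<close>

lemma root_rho_power_recurrence:
  "root_rho \<theta> ^ j + root_rho \<theta> ^ (j + 4) = (4 - 2 * cos \<theta>) * root_rho \<theta> ^ (j + 2)"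
proof -
  have "root_rho \<theta> ^ j + root_rho \<theta> ^ (j + 4) = root_rho \<theta> ^ j * (1 + root_rho \<theta> ^ 4)"
    by (simp add: power_add algebra_simps)
  also have "\<dots> = (4 - 2 * cos \<theta>) * root_rho \<theta> ^ (j + 2)"
    unfolding root_rho_quartic by (simp only: power_add mult_ac)
  finally show ?thesis .
qed

lemma P_harmonic:
  "P (Suc j) (n + 1) + P (Suc j) (n - 1) + P (Suc (Suc j)) n + P j n - 4 * P (Suc j) n = 0"
  unfolding P_eq
proof (intro inv_fourier_harmonic bounded_P_mult)
  show "P_mult j \<theta> + P_mult (Suc (Suc j)) \<theta> = of_real (4 - 2 * cos \<theta>) * P_mult (Suc j) \<theta>" for \<theta>
    using arg_cong[OF root_rho_power_recurrence[of \<theta> "2 * j"], of complex_of_real]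
    unfolding of_real_add of_real_mult P_mult_def by (simp add: numeral_eq_Suc)
qed

lemma Q_harmonic:
  "Q (Suc j) (n + 1) + Q (Suc j) (n - 1) + Q (Suc (Suc j)) n + Q j n - 4 * Q (Suc j) n = 0"
  unfolding Q_eq
proof (intro inv_fourier_harmonic bounded_Q_mult)
  fix \<theta>
  have "2 * Suc j + 1 = (2 * j + 1) + 2" "2 * Suc (Suc j) + 1 = (2 * j + 1) + 4" by simp_all
  then show "Q_mult j \<theta> + Q_mult (Suc (Suc j)) \<theta> = of_real (4 - 2 * cos \<theta>) * Q_mult (Suc j) \<theta>"
    unfolding Q_mult_def
    by (simp only: mult.assoc[symmetric] distrib_right[symmetric] of_real_add[symmetric]
        of_real_mult[symmetric] root_rho_power_recurrence)
qed

section \<open>Cauchy-Riemann identities for the kernels\<close>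

text \<open>Pulling out the half phase leaves \<open>E - 1 / E = 2 i sin (theta / 2)\<close>. The
  first form handles the forward shift of \<open>P\<close>, the second the backward shift of
  \<open>Q\<close>.\<close>

lemma cexp_half:
  fixes \<theta> :: real
  defines "E \<equiv> exp (\<i> * of_real \<theta> / 2)"
  shows "exp (\<i> * of_real \<theta>) - 1 = 2 * \<i> * of_real (sin (\<theta> / 2)) * E"
    and "E - exp (- (\<i> * of_real \<theta>)) * E = 2 * \<i> * of_real (sin (\<theta> / 2))"
proof -
  have s: "2 * \<i> * of_real (sin (\<theta> / 2)) = E - exp (- (\<i> * of_real \<theta> / 2))"
    by (simp add: E_def sin_exp_eq flip: sin_of_real)
  show "exp (\<i> * of_real \<theta>) - 1 = 2 * \<i> * of_real (sin (\<theta> / 2)) * E"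
    unfolding s E_def by (simp add: left_diff_distrib flip: exp_add)
  show "E - exp (- (\<i> * of_real \<theta>)) * E = 2 * \<i> * of_real (sin (\<theta> / 2))"
    unfolding s E_def by (simp flip: exp_add)
qed

text \<open>On this period \<open>theta / 2\<close> stays within \<open>(-pi/2, pi/2]\<close>, where
  the sine has the sign of its argument. Hence the multipliers are compared on the period only,
  through \<open>inv_fourier_cong\<close>.\<close>

lemma sgn_sin_half:
  assumes "- pi < \<theta>" "\<theta> \<le> pi"
  shows "sgn \<theta> * \<bar>sin (\<theta> / 2)\<bar> = sin (\<theta> / 2)" "sgn \<theta> * sin (\<theta> / 2) = \<bar>sin (\<theta> / 2)\<bar>"
  using assms sin_gt_zero[of "\<theta> / 2"] sin_gt_zero[of "- \<theta> / 2"] by (auto simp: sgn_if)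

text \<open>With \<open>r = root_rho theta\<close>, both sides have the multiplier
  \<open>2 i sin (theta / 2) exp (i theta / 2) r^(2 j + 2)\<close>.\<close>

lemma cauchy_riemann_kernel1:
  "P (Suc j) (n + 1) - P (Suc j) n = Q (Suc j) n - Q j n"
proof -
  have "inv_fourier (\<lambda>\<theta>. exp (\<i> * of_int 1 * of_real \<theta>) * P_mult (Suc j) \<theta> - P_mult (Suc j) \<theta>) n
      = inv_fourier (\<lambda>\<theta>. Q_mult (Suc j) \<theta> - Q_mult j \<theta>) n"
  proof (rule inv_fourier_cong)
    fix \<theta> :: real assume \<theta>: "- pi < \<theta>" "\<theta> \<le> pi"
    let ?r = "complex_of_real (root_rho \<theta>)" and ?E = "exp (\<i> * of_real \<theta> / 2)"
    have "Q_mult (Suc j) \<theta> - Q_mult j \<theta> = ?r ^ (2 * j + 1) * (1 - ?r\<^sup>2) * \<i> * of_real (sgn \<theta>) * ?E"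
      by (simp add: Q_mult_def power2_eq_square algebra_simps)
    also have "1 - ?r\<^sup>2 = 2 * of_real \<bar>sin (\<theta> / 2)\<bar> * ?r"
      using arg_cong[OF root_rho_identity[of \<theta>], of complex_of_real] by simp
    also have "?r ^ (2 * j + 1) * (2 * of_real \<bar>sin (\<theta> / 2)\<bar> * ?r) * \<i> * of_real (sgn \<theta>) * ?E
        = ?r ^ (2 * Suc j) * (2 * \<i> * of_real (sgn \<theta> * \<bar>sin (\<theta> / 2)\<bar>) * ?E)"
      by (simp add: mult_ac)
    also have "\<dots> = exp (\<i> * of_int 1 * of_real \<theta>) * P_mult (Suc j) \<theta> - P_mult (Suc j) \<theta>"
      unfolding sgn_sin_half(1)[OF \<theta>] cexp_half(1)[symmetric] by (simp add: P_mult_def algebra_simps)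
    finally show "exp (\<i> * of_int 1 * of_real \<theta>) * P_mult (Suc j) \<theta> - P_mult (Suc j) \<theta>
        = Q_mult (Suc j) \<theta> - Q_mult j \<theta>" ..
  qed
  then show ?thesis
    unfolding P_eq Q_eq
    by (simp only: inv_fourier_diff[OF bounded_Q_mult bounded_Q_mult] inv_fourier_shift
        inv_fourier_diff[OF bounded_multiplier_mult[OF bounded_multiplier_exp bounded_P_mult] bounded_P_mult])
qed

text \<open>Both sides have the multiplier \<open>- 2 |sin (theta / 2)| r^(2 k + 1)\<close>: the
  difference with the backward shift cancels the half phase of \<open>Q\<close>.\<close>

lemma cauchy_riemann_kernel2:
  "P (Suc k) n - P k n = - (Q k n - Q k (n - 1))"
proof -
  have "inv_fourier (\<lambda>\<theta>. P_mult (Suc k) \<theta> - P_mult k \<theta>) n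
      = inv_fourier (\<lambda>\<theta>. exp (\<i> * of_int (- 1) * of_real \<theta>) * Q_mult k \<theta> - Q_mult k \<theta>) n"
  proof (rule inv_fourier_cong)
    fix \<theta> :: real assume \<theta>: "- pi < \<theta>" "\<theta> \<le> pi"
    let ?r = "complex_of_real (root_rho \<theta>)" and ?E = "exp (\<i> * of_real \<theta> / 2)"
    have "exp (\<i> * of_int (- 1) * of_real \<theta>) * Q_mult k \<theta> - Q_mult k \<theta>
        = ?r ^ (2 * k + 1) * \<i> * of_real (sgn \<theta>) * (?E - exp (- (\<i> * of_real \<theta>)) * ?E)"
      by (simp add: Q_mult_def algebra_simps)
    also have "\<dots> = - (?r ^ (2 * k) * (2 * of_real (sgn \<theta> * sin (\<theta> / 2)) * ?r))"
      unfolding cexp_half(2) by (simp add: mult_ac)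
    also have "2 * of_real (sgn \<theta> * sin (\<theta> / 2)) * ?r = 1 - ?r\<^sup>2"
      unfolding sgn_sin_half(2)[OF \<theta>] using arg_cong[OF root_rho_identity[of \<theta>], of complex_of_real] by simp
    also have "- (?r ^ (2 * k) * (1 - ?r\<^sup>2)) = P_mult (Suc k) \<theta> - P_mult k \<theta>"
      by (simp add: P_mult_def power2_eq_square algebra_simps)
    finally show "P_mult (Suc k) \<theta> - P_mult k \<theta>
        = exp (\<i> * of_int (- 1) * of_real \<theta>) * Q_mult k \<theta> - Q_mult k \<theta>" ..
  qed
  then show ?thesis
    unfolding P_eq Q_eq
    by (simp only: inv_fourier_diff[OF bounded_P_mult bounded_P_mult] inv_fourier_shift
        inv_fourier_diff[OF bounded_multiplier_mult[OF bounded_multiplier_exp bounded_Q_mult] bounded_Q_mult])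
      simp
qed

section \<open>Boundary values and passage from the kernels to \<open>U\<close> and
  \<open>V\<close>\<close>

lemma P_0: "P 0 n = (if n = 0 then 1 else 0)"
  using inv_fourier_one[of n] by (simp add: P_eq P_mult_def[abs_def])

text \<open>\<open>conv\<close> is 0 by default when its sum diverges; the first conjunct therefore
  records convergence, so that the identities concern genuine sums.\<close>

theorem theorem1p2:
  fixes p :: real and a :: "int \<Rightarrow> complex"
  assumes "1 < p" and "in_lp p a"
  shows
    "(\<forall>n k. (\<lambda>m. P k (n - m) * a m) summable_on UNIV \<and>
            (\<lambda>m. Q k (n - m) * a m) summable_on UNIV) \<and>
     (\<forall>F \<in> {U a, V a}. \<forall>n. \<forall>k \<ge> 1.
        F (n + 1) k + F (n - 1) k + F n (k + 1) + F n (k - 1) - 4 * F n k = 0) \<and>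
     (\<forall>n. U a n 0 = a n \<and> V a n 0 = H_d a n) \<and>
     (\<forall>n. \<forall>k \<ge> 1.
        U a (n + 1) k - U a n k = V a n k - V a n (k - 1) \<and>
        U a n (k + 1) - U a n k = - (V a n k - V a (n - 1) k))"
proof -
  \<comment> \<open>The exponent conjugate to \<open>p\<close>, above 1 because
    \<open>p - 1 < p\<close>, so the kernels lie in its sequence space.\<close>
  define q where "q = p / (p - 1)"
  have q: "1 < q" "1 / q + 1 / p = 1"
    using assms(1) by (auto simp: q_def field_simps)
  have sP: "(\<lambda>m. P k (n - m) * a m) summable_on UNIV" for n k
    by (rule conv_summable[OF assms q(1) P_in_lp[OF q(1)] q(2)])
  have sQ: "(\<lambda>m. Q k (n - m) * a m) summable_on UNIV" for n k
    by (rule conv_summable[OF assms q(1) Q_in_lp[OF q(1)] q(2)])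
  have hU: "((\<lambda>m. P k (n - m) * a m) has_sum U a n k) UNIV" for n k
    unfolding U_def conv_def by (rule has_sum_infsum[OF sP])
  have hV: "((\<lambda>m. Q k (n - m) * a m) has_sum V a n k) UNIV" for n k
    unfolding V_def conv_def by (rule has_sum_infsum[OF sQ])
  \<comment> \<open>Stated for a generic kernel to serve both \<open>P\<close> and \<open>Q\<close>:
    the combined terms vanish for each \<open>m\<close>, and uniqueness of sums gives 0.\<close>
  have harmonic: "F (n + 1) (Suc j) + F (n - 1) (Suc j) + F n (Suc (Suc j)) + F n j - 4 * F n (Suc j) = 0"
    if F: "\<And>n k. ((\<lambda>m. K k (n - m) * a m) has_sum F n k) UNIV"
      and K: "\<And>n. K (Suc j) (n + 1) + K (Suc j) (n - 1) + K (Suc (Suc j)) n + K j n - 4 * K (Suc j) n = 0"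
    for F :: "int \<Rightarrow> nat \<Rightarrow> complex" and K n j
  proof -
    have "((\<lambda>m. K (Suc j) (n + 1 - m) * a m + K (Suc j) (n - 1 - m) * a m + K (Suc (Suc j)) (n - m) * a m
        + K j (n - m) * a m - 4 * (K (Suc j) (n - m) * a m)) has_sum
        F (n + 1) (Suc j) + F (n - 1) (Suc j) + F n (Suc (Suc j)) + F n j - 4 * F n (Suc j)) UNIV"
      by (intro has_sum_diff has_sum_add has_sum_cmult_right F)
    moreover have "K (Suc j) (n + 1 - m) * a m + K (Suc j) (n - 1 - m) * a m + K (Suc (Suc j)) (n - m) * a m
        + K j (n - m) * a m - 4 * (K (Suc j) (n - m) * a m) = 0" for m
    proof -
      \<comment> \<open>Regrouping turns a shift of \<open>n\<close> into a shift of the kernel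
        argument \<open>n - m\<close>, where \<open>K\<close> applies.\<close>
      have eq: "n + 1 - m = (n - m) + 1" "n - 1 - m = (n - m) - 1" by simp_all
      show ?thesis
        unfolding eq using arg_cong[OF K[of "n - m"], of "\<lambda>z. z * a m"] by (simp add: ring_distribs)
    qed
    ultimately show ?thesis
      by (rule has_sum_unique[OF _ has_sum_0])
  qed
  have cr1: "U a (n + 1) (Suc j) - U a n (Suc j) = V a n (Suc j) - V a n j" for n j
  proof -
    have "P (Suc j) (n + 1 - m) * a m - P (Suc j) (n - m) * a m = Q (Suc j) (n - m) * a m - Q j (n - m) * a m" for m
      using arg_cong[OF cauchy_riemann_kernel1[of j "n - m"], of "\<lambda>z. z * a m"]
      by (simp add: left_diff_distrib diff_add_eq)
    then show ?thesis
      using has_sum_diff[OF hU[of "Suc j" "n + 1"] hU[of "Suc j" n]] has_sum_diff[OF hV[of "Suc j" n] hV[of j n]]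
        has_sum_unique by simp
  qed
  have cr2: "U a n (Suc k) - U a n k = - (V a n k - V a (n - 1) k)" for n k
  proof -
    have "P (Suc k) (n - m) * a m - P k (n - m) * a m = Q k (n - 1 - m) * a m - Q k (n - m) * a m" for m
    proof -
      have eq: "n - 1 - m = (n - m) - 1" by simp
      show ?thesis
        unfolding eq left_diff_distrib[symmetric] cauchy_riemann_kernel2 by simp
    qed
    then show ?thesis
      using has_sum_diff[OF hU[of "Suc k" n] hU[of k n]] has_sum_diff[OF hV[of k "n - 1"] hV[of k n]]
        has_sum_unique by simp
  qed
  have U0: "U a n 0 = a n" for n
  proof -
    \<comment> \<open>Only the term \<open>m = n\<close> survives, because \<open>P 0\<close> is the
      unit mass at 0.\<close>
    have "((\<lambda>m. P 0 (n - m) * a m) has_sum a n) UNIV"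
      by (rule has_sum_finite_neutralI[of "{n}"]) (auto simp: P_0)
    then show ?thesis
      using hU has_sum_unique by blast
  qed
  have V0: "V a n 0 = H_d a n" for n
    by (simp add: V_def H_d_def K_d_eq)
  have "F (n + 1) k + F (n - 1) k + F n (k + 1) + F n (k - 1) - 4 * F n k = 0"
    if "F \<in> {U a, V a}" "k \<ge> 1" for F n k
  proof -
    obtain j where k: "k = Suc j" using \<open>k \<ge> 1\<close> by (cases k) auto
    show ?thesis
      using that(1) harmonic[of P "U a" j n, OF hU P_harmonic] harmonic[of Q "V a" j n, OF hV Q_harmonic]
      by (auto simp: k)
  qed
  moreover have "U a (n + 1) k - U a n k = V a n k - V a n (k - 1)" if "k \<ge> 1" for n k
    using cr1[of n "k - 1"] that by simp
  ultimately show ?thesis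
    using sP sQ U0 V0 cr2 by simp
qed

end
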